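(* Let $p$ be an odd prime and let $G$ be a finite $p$-solvable group such that every maximal subgroup of $G$ is either $p$-nilpotent or has prime index in $G$. Then ${\bf O}_{p',p,p',p,p'}(G)=G$. In particular, the $p$-length of $G$ satisfies $l_p(G)\le 2$.
   Context: A group is $p$-nilpotent if it has a normal Hall $p'$-subgroup. A maximal subgroup means a maximal proper subgroup. ${\bf O}_{p'}(G)$ is the largest normal $p'$-subgroup and ${\bf O}_p(G)$ the largest normal $p$-subgroup of $G$; the upper $p'p$-series is defined recursively: ${\bf O}_{p',p}(G)$ is the full preimage of ${\bf O}_p(G/{\bf O}_{p'}(G))$, ${\bf O}_{p',p,p'}(G)$ the full preimage of ${\bf O}_{p'}(G/{\bf O}_{p',p}(G))$, and so on alternately. The $p$-length $l_p(G)$ of a $p$-solvable group is the number of $p$-group factors in its upper $p'p$-series (equivalently, the minimal number of $p$-factors in a normal series whose factors are $p$-groups or $p'$-groups). *)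

theory Defs
  imports "HOL-Algebra.Algebra"
begin

definition is_p_set :: "nat \<Rightarrow> 'a set \<Rightarrow> bool" where
  "is_p_set p N \<longleftrightarrow> finite N \<and> (\<exists>k. card N = p ^ k)"

definition is_p'_set :: "nat \<Rightarrow> 'a set \<Rightarrow> bool" where
  "is_p'_set p N \<longleftrightarrow> finite N \<and> \<not> p dvd card N"

definition O_p :: "nat \<Rightarrow> ('a, 'b) monoid_scheme \<Rightarrow> 'a set" where
  "O_p p H = (GREATEST N. N \<lhd> H \<and> is_p_set p N)"

definition O_p' :: "nat \<Rightarrow> ('a, 'b) monoid_scheme \<Rightarrow> 'a set" where
  "O_p' p H = (GREATEST N. N \<lhd> H \<and> is_p'_set p N)"

text \<open>Upper p'p-series: S 0 = 1, S 1 = O_{p'}(G), S 2 = O_{p',p}(G), S 3 = O_{p',p,p'}(G), ...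
  S (n+1) is the full preimage in G of O_{p'}(G/S n) (n even) resp. O_p(G/S n) (n odd).\<close>
fun upper_pp_series :: "nat \<Rightarrow> ('a, 'b) monoid_scheme \<Rightarrow> nat \<Rightarrow> 'a set" where
  "upper_pp_series p G 0 = {\<one>\<^bsub>G\<^esub>}"
| "upper_pp_series p G (Suc n) =
     (if even n then \<Union> (O_p' p (G Mod upper_pp_series p G n))
      else \<Union> (O_p p (G Mod upper_pp_series p G n)))"

definition p_length :: "nat \<Rightarrow> ('a, 'b) monoid_scheme \<Rightarrow> nat" where
  "p_length p G = card {n. odd n \<and> upper_pp_series p G n \<noteq> upper_pp_series p G (Suc n)}"

definition p_solvable :: "nat \<Rightarrow> ('a, 'b) monoid_scheme \<Rightarrow> bool" where
  "p_solvable p G \<longleftrightarrow> (\<exists>n (S :: nat \<Rightarrow> 'a set).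
      S 0 = {\<one>\<^bsub>G\<^esub>} \<and> S n = carrier G \<and>
      (\<forall>i<n. subgroup (S i) G \<and> subgroup (S (Suc i)) G \<and> S i \<subseteq> S (Suc i) \<and>
              S i \<lhd> G\<lparr>carrier := S (Suc i)\<rparr> \<and>
              (is_p_set p (carrier (G\<lparr>carrier := S (Suc i)\<rparr> Mod S i)) \<or>
               is_p'_set p (carrier (G\<lparr>carrier := S (Suc i)\<rparr> Mod S i)))))"

definition p_nilpotent_subgroup :: "nat \<Rightarrow> ('a, 'b) monoid_scheme \<Rightarrow> 'a set \<Rightarrow> bool" where
  "p_nilpotent_subgroup p G M \<longleftrightarrow> subgroup M G \<and>
     (\<exists>N. N \<lhd> G\<lparr>carrier := M\<rparr> \<and> is_p'_set p N \<and> (\<exists>k. card M = card N * p ^ k))"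

definition maximal_subgroup :: "('a, 'b) monoid_scheme \<Rightarrow> 'a set \<Rightarrow> bool" where
  "maximal_subgroup G M \<longleftrightarrow> subgroup M G \<and> M \<noteq> carrier G \<and>
     (\<forall>H. subgroup H G \<and> M \<subseteq> H \<longrightarrow> H = M \<or> H = carrier G)"

end

theory Submission
  imports Defs
begin

text \<open>
  Write \<open>R \<subseteq> P \<subseteq> A\<close> for the first three nontrivial terms of the upper series. Suppose a maximal
  subgroup \<open>M\<close> is \<open>p\<close>-nilpotent with normal \<open>p'\<close>-Hall subgroup \<open>N\<close>. If \<open>A \<subseteq> M\<close>, then
  \<open>N \<inter> A\<close> lies in the largest normal \<open>p'\<close>-subgroup of \<open>A\<close>, hence in \<open>R\<close>, so \<open>A/R\<close> is a \<open>p\<close>-group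
  and \<open>A = P\<close>; by \<open>p\<close>-solvability \<open>P = G\<close>. If \<open>A\<close> is not contained in \<open>M\<close>, then \<open>G = AM\<close>, the
  subgroup \<open>AN\<close> is normal and \<open>AN/P\<close> is a \<open>p'\<close>-group, so \<open>AN = A\<close> and \<open>G/A\<close> is a \<open>p\<close>-group.
  If on the other hand all maximal subgroups have prime index, let \<open>q\<close> be the largest prime
  divisor of \<open>|G/R|\<close> and \<open>Q\<close> a Sylow \<open>q\<close>-subgroup of \<open>G\<close>. Then \<open>RQ\<close> is normal, which forces
  \<open>q = p\<close> and \<open>G = A\<close>. In every case the fourth term of the series is already \<open>G\<close>.

  Quotient groups are avoided: a section \<open>K/N\<close> only enters through the number \<open>|K|/|N|\<close>.
\<close>

section \<open>Classes of indices and sections described by their order\<close>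

text \<open>Treats the powers of \<open>p\<close> and the numbers prime to \<open>p\<close> at once,
  so that each fact about \<open>O_p\<close> and \<open>O_p'\<close> is proved a single time. One
  direction of the equivalence gives closure under extensions, the other closure under subgroups and
  quotients.\<close>

definition mult_closed_class :: "(nat \<Rightarrow> bool) \<Rightarrow> bool" where
  "mult_closed_class P \<longleftrightarrow> P 1 \<and> (\<forall>m>0. \<forall>n>0. P (m * n) \<longleftrightarrow> P m \<and> P n)"

text \<open>For finite subgroups, \<open>m\<close> is the index of \<open>N\<close> in
  \<open>K\<close>. With \<open>N\<close> trivial this says that the order of \<open>K\<close>
  itself lies in the class.\<close>

definition index_in :: "(nat \<Rightarrow> bool) \<Rightarrow> 'a set \<Rightarrow> 'a set \<Rightarrow> bool" where
  "index_in P N K \<longleftrightarrow> N \<subseteq> K \<and> (\<exists>m. card K = card N * m \<and> P m)"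

text \<open>This is the full preimage of the largest normal \<open>P\<close>-subgroup of
  \<open>G/N\<close>, that is, one step of the upper series. \<open>GREATEST\<close> refers to
  inclusion; such a greatest element exists when \<open>G\<close> is finite and \<open>P\<close> is
  multiplicatively closed.\<close>

definition greatest_ext :: "(nat \<Rightarrow> bool) \<Rightarrow> ('a, 'b) monoid_scheme \<Rightarrow> 'a set \<Rightarrow> 'a set" where
  "greatest_ext P G N = (GREATEST K. K \<lhd> G \<and> index_in P N K)"

lemma mult_closed_class_prime_power:
  assumes "Factorial_Ring.prime (p::nat)"
  shows "mult_closed_class (\<lambda>m. \<exists>k. m = p ^ k)"
  unfolding mult_closed_class_def
proof (intro conjI allI impI)
  show "\<exists>k. 1 = p ^ k" by (metis power_0)
  show "(\<exists>k. m * n = p ^ k) \<longleftrightarrow> (\<exists>k. m = p ^ k) \<and> (\<exists>k. n = p ^ k)" for m n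
    using assms by (metis divides_primepow_nat dvd_triv_left dvd_triv_right power_add)
qed

lemma mult_closed_class_not_dvd:
  assumes "Factorial_Ring.prime (p::nat)"
  shows "mult_closed_class (\<lambda>m. \<not> p dvd m)"
  unfolding mult_closed_class_def using assms not_prime_1 by (auto simp: prime_dvd_mult_iff)

lemma index_in_refl: "mult_closed_class P \<Longrightarrow> index_in P N N"
  unfolding index_in_def mult_closed_class_def by force

lemma index_in_trans:
  assumes P: "mult_closed_class P" and pos: "card L > 0"
    and NK: "index_in P N K" and KL: "index_in P K L"
  shows "index_in P N L"
proof -
  obtain m n where mn: "card K = card N * m" "card L = card K * n" "P m" "P n"
    using NK KL unfolding index_in_def by blast
  have "m > 0" "n > 0" using mn pos by auto
  then have "P (m * n)" using P mn unfolding mult_closed_class_def by blast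
  then show ?thesis
    using NK KL mn unfolding index_in_def by (metis mult.assoc order_trans)
qed

section \<open>Orders of subgroups and of products with a normal subgroup\<close>

lemma (in group) carrier_normal: "carrier G \<lhd> G"
  by (rule normal_invI[OF subgroup_self]) simp

lemma (in group) card_subgroup_dvd:
  assumes "subgroup H G" "subgroup K G" "H \<subseteq> K"
  shows "card H dvd card K"
proof -
  interpret K: group "G\<lparr>carrier := K\<rparr>" by (rule subgroup_imp_group[OF assms(2)])
  have "subgroup H (G\<lparr>carrier := K\<rparr>)" using assms subgroup_incl by blast
  from K.lagrange[OF this] have "card (rcosets\<^bsub>G\<lparr>carrier := K\<rparr>\<^esub> H) * card H = card K"
    by (simp add: order_def)
  then show ?thesis by (metis dvd_triv_right)
qed

lemma (in group) card_subgroup_pos: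
  "finite (carrier G) \<Longrightarrow> subgroup H G \<Longrightarrow> card H > 0"
  by (metis card_gt_0_iff empty_iff finite_subset subgroup.one_closed subgroup.subset)

text \<open>Indices multiply along \<open>H\<close>, \<open>K\<close>, \<open>L\<close>, and a
  factor of a number in the class is again in the class.\<close>

lemma (in group) index_in_between:
  assumes fin: "finite (carrier G)" and P: "mult_closed_class P"
    and H: "subgroup H G" and K: "subgroup K G" and L: "subgroup L G"
    and sub: "H \<subseteq> K" "K \<subseteq> L" and HL: "index_in P H L"
  shows "index_in P H K" "index_in P K L"
proof -
  obtain m where m: "card L = card H * m" "P m" using HL unfolding index_in_def by blast
  obtain a b where ab: "card K = card H * a" "card L = card K * b"
    using card_subgroup_dvd[OF H K sub(1)] card_subgroup_dvd[OF K L sub(2)] by (meson dvd_def)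
  have "card L > 0" by (rule card_subgroup_pos[OF fin L])
  then have "m = a * b" "a > 0" "b > 0" using m ab by auto
  then have "P a" "P b" using P m(2) unfolding mult_closed_class_def by blast+
  then show "index_in P H K" "index_in P K L" using ab sub unfolding index_in_def by blast+
qed

lemma (in group) set_mult_normal_subgroup:
  assumes "N \<lhd> G" "subgroup S G"
  shows "subgroup (N <#> S) G" "N \<subseteq> N <#> S" "S \<subseteq> N <#> S"
proof -
  interpret second_isomorphism_grp N G S
    using assms by (simp add: second_isomorphism_grp_axioms_def second_isomorphism_grp_def)
  show "subgroup (N <#> S) G" "N \<subseteq> N <#> S" "S \<subseteq> N <#> S"
    by (rule normal_set_mult_subgroup H_contained_in_set_mult S_contained_in_set_mult)+
qed

lemma (in group) set_mult_subset_subgroup: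
  "subgroup H G \<Longrightarrow> A \<subseteq> H \<Longrightarrow> B \<subseteq> H \<Longrightarrow> A <#> B \<subseteq> H"
  unfolding set_mult_def using subgroup.m_closed by fastforce

lemma (in group) set_mult_normal_absorb:
  "N \<lhd> G \<Longrightarrow> subgroup S G \<Longrightarrow> N \<subseteq> S \<Longrightarrow> N <#> S = S"
  by (simp add: set_mult_normal_subgroup(3) set_mult_subset_subgroup subset_antisym)

text \<open>The second isomorphism theorem identifies \<open>S/(N \<inter> S)\<close> with
  \<open>NS/N\<close>; Lagrange on both sides gives the product formula.\<close>

lemma (in group) card_set_mult:
  assumes N: "N \<lhd> G" and S: "subgroup S G"
  shows "card (N <#> S) * card (N \<inter> S) = card N * card S"
proof -
  interpret second_isomorphism_grp N G S
    using assms by (simp add: second_isomorphism_grp_axioms_def second_isomorphism_grp_def)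
  let ?T = "N <#> S"
  note T = set_mult_normal_subgroup[OF N S]
  interpret S: group "G\<lparr>carrier := S\<rparr>" by (rule subgroup_imp_group[OF S])
  interpret T: group "G\<lparr>carrier := ?T\<rparr>" by (rule subgroup_imp_group[OF T(1)])
  have "subgroup (N \<inter> S) G" using N S normal_imp_subgroup subgroups_Inter_pair by blast
  then have "subgroup (N \<inter> S) (G\<lparr>carrier := S\<rparr>)" using S subgroup_incl by blast
  from S.lagrange[OF this]
  have 1: "card (carrier (G\<lparr>carrier := S\<rparr> Mod (N \<inter> S))) * card (N \<inter> S) = card S"
    by (simp add: FactGroup_def order_def)
  have "subgroup N (G\<lparr>carrier := ?T\<rparr>)"
    using N T normal_imp_subgroup subgroup_incl by blast
  from T.lagrange[OF this]
  have 2: "card (carrier (G\<lparr>carrier := ?T\<rparr> Mod N)) * card N = card ?T"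
    by (simp add: FactGroup_def order_def)
  have "card (carrier (G\<lparr>carrier := S\<rparr> Mod (N \<inter> S))) = card (carrier (G\<lparr>carrier := ?T\<rparr> Mod N))"
    using normal_intersection_quotient_isom by (auto simp: iso_def dest: bij_betw_same_card)
  then show ?thesis unfolding 1[symmetric] 2[symmetric] by (simp add: ac_simps)
qed

text \<open>By the product formula, the index of \<open>A\<close> in \<open>K\<close> is the index
  of \<open>BA\<close> in \<open>BK\<close> times that of \<open>B \<inter> A\<close> in
  \<open>B \<inter> K\<close>. Both factors therefore stay in the class.\<close>

lemma (in group) index_in_set_mult:
  assumes fin: "finite (carrier G)" and P: "mult_closed_class P"
    and B: "B \<lhd> G" and A: "subgroup A G" and K: "subgroup K G" and AK: "index_in P A K"
  shows "index_in P (B <#> A) (B <#> K)" "index_in P (B \<inter> A) (B \<inter> K)"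
proof -
  have sub: "A \<subseteq> K" using AK unfolding index_in_def by blast
  obtain m where m: "card K = card A * m" "P m" using AK unfolding index_in_def by blast
  have Bs: "subgroup B G" using B normal_imp_subgroup by blast
  have BA: "subgroup (B \<inter> A) G" "subgroup (B \<inter> K) G"
    using Bs A K subgroups_Inter_pair by blast+
  have sub': "B <#> A \<subseteq> B <#> K" "B \<inter> A \<subseteq> B \<inter> K"
    using sub mono_set_mult[of B B A K G] by blast+
  obtain a where a: "card (B <#> K) = card (B <#> A) * a"
    using card_subgroup_dvd[OF _ _ sub'(1)] set_mult_normal_subgroup(1)[OF B] A K by (meson dvd_def)
  obtain b where b: "card (B \<inter> K) = card (B \<inter> A) * b"
    using card_subgroup_dvd[OF BA sub'(2)] by (meson dvd_def)
  have pos: "card K > 0" "card A > 0" "card B > 0" "card (B \<inter> K) > 0"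
      "card (B <#> K) > 0"
    using card_subgroup_pos[OF fin] A K Bs BA set_mult_normal_subgroup(1)[OF B] by blast+
  have "card B * card A * m = card (B <#> K) * card (B \<inter> K)"
    using card_set_mult[OF B K] m(1) by simp
  also have "\<dots> = card (B <#> A) * card (B \<inter> A) * (a * b)" using a b by simp
  also have "\<dots> = card B * card A * (a * b)" using card_set_mult[OF B A] by simp
  finally have "m = a * b" using pos by simp
  moreover have "a > 0" "b > 0" using a b pos by auto
  ultimately have "P a" "P b" using P m(2) unfolding mult_closed_class_def by blast+
  then show "index_in P (B <#> A) (B <#> K)" "index_in P (B \<inter> A) (B \<inter> K)"
    using a b sub' unfolding index_in_def by blast+
qed

section \<open>Greatest normal extensions and the upper series\<close>

text \<open>If \<open>K\<close> and \<open>L\<close> are normal extensions of \<open>N\<close> with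
  index in the class, so is \<open>KL\<close>, because the index of \<open>K = KN\<close> in
  \<open>KL\<close> divides that of \<open>N\<close> in \<open>L\<close>. By finiteness there is a
  maximal extension, and it must contain every other.\<close>

lemma (in group) greatest_ext:
  assumes fin: "finite (carrier G)" and P: "mult_closed_class P" and N: "N \<lhd> G"
  shows "greatest_ext P G N \<lhd> G" "index_in P N (greatest_ext P G N)"
    and "\<And>K. K \<lhd> G \<Longrightarrow> index_in P N K \<Longrightarrow> K \<subseteq> greatest_ext P G N"
proof -
  let ?A = "{K. K \<lhd> G \<and> index_in P N K}"
  have "?A \<subseteq> Pow (carrier G)" using normal_imp_subgroup subgroup.subset by blast
  then have "finite ?A" using fin by (meson finite_Pow_iff finite_subset)
  moreover have "N \<in> ?A" using N index_in_refl[OF P] by blast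
  ultimately obtain K where K: "K \<in> ?A" and max: "\<forall>L\<in>?A. K \<subseteq> L \<longrightarrow> K = L"
    using finite_has_maximal[of ?A] by blast
  have great: "L \<subseteq> K" if L: "L \<lhd> G" "index_in P N L" for L
  proof -
    have Ls: "subgroup L G" "subgroup K G" "subgroup N G" using L K N normal_imp_subgroup by blast+
    have "index_in P (K <#> N) (K <#> L)"
      using index_in_set_mult(1)[OF fin P] K Ls L by blast
    moreover have "K <#> N = K"
    proof -
      have "N \<subseteq> K" using K unfolding index_in_def by blast
      then have "K <#> N \<subseteq> K" using Ls set_mult_subset_subgroup by blast
      then show ?thesis using set_mult_normal_subgroup(2) K Ls by blast
    qed
    moreover have "K <#> L \<lhd> G" using K L normal_subgroup_set_mult_closed by blast
    moreover have "card (K <#> L) > 0"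
      using set_mult_normal_subgroup(1)[of K L] K Ls card_subgroup_pos[OF fin] by blast
    ultimately have "K <#> L \<in> ?A" using K index_in_trans[OF P] by auto
    then have "K = K <#> L" using max set_mult_normal_subgroup(2)[of K L] K Ls by blast
    then show ?thesis using set_mult_normal_subgroup(3) K Ls by blast
  qed
  have "greatest_ext P G N = K"
    unfolding greatest_ext_def using K great by (intro Greatest_equality) auto
  then show "greatest_ext P G N \<lhd> G" "index_in P N (greatest_ext P G N)"
    and "\<And>K. K \<lhd> G \<Longrightarrow> index_in P N K \<Longrightarrow> K \<subseteq> greatest_ext P G N"
    using K great by auto
qed

lemma (in group) Union_rcosets_in_subgroup:
  assumes "N \<lhd> G" "subgroup K G" "N \<subseteq> K"
  shows "\<Union> (rcosets\<^bsub>G\<lparr>carrier := K\<rparr>\<^esub> N) = K"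
    and "card (rcosets\<^bsub>G\<lparr>carrier := K\<rparr>\<^esub> N) * card N = card K"
proof -
  interpret K: group "G\<lparr>carrier := K\<rparr>" by (rule subgroup_imp_group[OF assms(2)])
  have "subgroup N (G\<lparr>carrier := K\<rparr>)" using assms normal_imp_subgroup subgroup_incl by blast
  then show "\<Union> (rcosets\<^bsub>G\<lparr>carrier := K\<rparr>\<^esub> N) = K"
    "card (rcosets\<^bsub>G\<lparr>carrier := K\<rparr>\<^esub> N) * card N = card K"
    using K.rcosets_part_G K.lagrange by (auto simp: order_def)
qed

text \<open>Correspondence theorem: unions of cosets match the normal subgroups of
  \<open>G Mod N\<close> with the normal subgroups of \<open>G\<close> above \<open>N\<close>, and
  orders become indices. This translates the quotients in the definition of the series into
  \<open>greatest_ext\<close>.\<close>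

lemma (in group) Union_greatest_normal_FactGroup:
  assumes fin: "finite (carrier G)" and P: "mult_closed_class P" and N: "N \<lhd> G"
  shows "\<Union> (GREATEST Z. Z \<lhd> (G Mod N) \<and> finite Z \<and> P (card Z)) = greatest_ext P G N"
proof -
  let ?K = "greatest_ext P G N"
  note K = greatest_ext[OF fin P N]
  interpret N: normal N G by (rule N)
  have NK: "N \<subseteq> ?K" using K(2) unfolding index_in_def by blast
  have Ks: "subgroup ?K G" using K(1) normal_imp_subgroup by blast
  let ?X = "rcosets\<^bsub>G\<lparr>carrier := ?K\<rparr>\<^esub> N"
  note X = Union_rcosets_in_subgroup[OF N Ks NK]
  have fins: "finite H" if "subgroup H G" for H
    using that fin finite_subset subgroup.subset by blast
  have posN: "card N > 0" by (rule card_subgroup_pos[OF fin N.is_subgroup])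
  have "(GREATEST Z. Z \<lhd> (G Mod N) \<and> finite Z \<and> P (card Z)) = ?X"
  proof (rule Greatest_equality)
    have "finite ?X" using X(1) fins[OF Ks] finite_UnionD by metis
    moreover have "P (card ?X)"
      using K(2) X(2) posN unfolding index_in_def by (metis mult.commute mult_cancel_left not_less0)
    ultimately show "?X \<lhd> (G Mod N) \<and> finite ?X \<and> P (card ?X)"
      using normality_factorization[OF N NK K(1)] by blast
  next
    fix Y assume Y: "Y \<lhd> (G Mod N) \<and> finite Y \<and> P (card Y)"
    then have Ys: "subgroup Y (G Mod N)" using normal_imp_subgroup by blast
    have U: "\<Union>Y \<lhd> G" using Y N.factgroup_subgroup_union_normal by blast
    have Us: "subgroup (\<Union>Y) G" using U normal_imp_subgroup by blast
    have eq: "Y = rcosets\<^bsub>G\<lparr>carrier := \<Union>Y\<rparr>\<^esub> N"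
      by (rule N.factgroup_subgroup_union_factor[OF Ys])
    have NY: "N \<subseteq> \<Union>Y" using subgroup.one_closed[OF Ys] by auto
    have "card (\<Union>Y) = card N * card Y"
      using Union_rcosets_in_subgroup(2)[OF N Us NY] eq by (metis mult.commute)
    then have "index_in P N (\<Union>Y)" using NY Y unfolding index_in_def by blast
    then have "\<Union>Y \<subseteq> ?K" using K(3) U by blast
    then have "rcosets\<^bsub>G\<lparr>carrier := \<Union>Y\<rparr>\<^esub> N \<subseteq> ?X" by (auto simp: RCOSETS_def)
    then show "Y \<le> ?X" using eq by simp
  qed
  then show ?thesis using X(1) by simp
qed

lemma (in group) upper_pp_series_Suc:
  assumes fin: "finite (carrier G)" and p: "Factorial_Ring.prime p"
    and N: "upper_pp_series p G n \<lhd> G"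
  shows "upper_pp_series p G (Suc n) =
    greatest_ext (if even n then (\<lambda>m. \<not> p dvd m) else (\<lambda>m. \<exists>k. m = p ^ k)) G (upper_pp_series p G n)"
  using Union_greatest_normal_FactGroup[OF fin mult_closed_class_not_dvd[OF p] N]
    Union_greatest_normal_FactGroup[OF fin mult_closed_class_prime_power[OF p] N]
  by (simp add: O_p_def O_p'_def is_p_set_def is_p'_set_def)

lemma (in group) upper_pp_series_normal:
  assumes fin: "finite (carrier G)" and p: "Factorial_Ring.prime p"
  shows "upper_pp_series p G n \<lhd> G"
proof (induction n)
  case 0
  show ?case by (simp add: one_is_normal)
next
  case (Suc n)
  show ?case
    unfolding upper_pp_series_Suc[OF fin p Suc]
    using greatest_ext(1)[OF fin _ Suc] mult_closed_class_not_dvd[OF p] mult_closed_class_prime_power[OF p]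
    by simp
qed

section \<open>Subnormal chains and p-solvability\<close>

text \<open>Conjugation by an element of \<open>G\<close> is an automorphism of \<open>A\<close>
  that preserves \<open>N\<close>. It sends the greatest extension to another normal extension of
  \<open>N\<close> with the same index, which by maximality lies in the greatest one.\<close>

lemma (in group) greatest_ext_normal_in:
  assumes fin: "finite (carrier G)" and P: "mult_closed_class P"
    and A: "A \<lhd> G" and N: "N \<lhd> G" and NA: "N \<subseteq> A"
  shows "greatest_ext P (G\<lparr>carrier := A\<rparr>) N \<lhd> G"
proof -
  let ?A = "G\<lparr>carrier := A\<rparr>" and ?K = "greatest_ext P (G\<lparr>carrier := A\<rparr>) N"
  have As: "subgroup A G" using A normal_imp_subgroup by blast
  interpret A: group ?A by (rule subgroup_imp_group[OF As])
  have finA: "finite (carrier ?A)" using finite_subset[OF subgroup.subset[OF As] fin] by simp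
  have N': "N \<lhd> ?A" by (rule normal_restrict_supergroup[OF As N NA])
  note K = A.greatest_ext[OF finA P N']
  have KA: "subgroup ?K ?A" using K(1) normal_imp_subgroup by blast
  have Ks: "subgroup ?K G" using incl_subgroup[OF As KA] .
  show ?thesis
  proof (rule normal_invI[OF Ks])
    fix g h assume g: "g \<in> carrier G" and h: "h \<in> ?K"
    let ?f = "\<lambda>x. g \<otimes> x \<otimes> inv g"
    have Ac: "A \<subseteq> carrier G" using As subgroup.subset by blast
    have onto: "\<exists>y\<in>B. ?f y = x" if "B \<lhd> G" "x \<in> B" for B x
    proof
      have "x \<in> carrier G" by (rule subgroup.mem_carrier[OF normal_imp_subgroup[OF that(1)] that(2)])
      then show "?f (inv g \<otimes> x \<otimes> g) = x" using conjugation_is_surj[OF g] by simp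
      show "inv g \<otimes> x \<otimes> g \<in> B" by (rule normal.inv_op_closed1[OF that(1) g that(2)])
    qed
    have inj: "inj_on ?f A"
      by (rule inj_onI) (use Ac conjugation_is_inj[OF g] in blast)
    have into: "?f x \<in> A" if "x \<in> A" for x using normal_invE(2)[OF A g that] .
    have im: "?f ` A = A"
    proof
      show "?f ` A \<subseteq> A" using into by blast
      show "A \<subseteq> ?f ` A" using onto[OF A] by blast
    qed
    then have "?f \<in> iso ?A ?A"
    proof -
      have "?f (x \<otimes> y) = ?f x \<otimes> ?f y" if "x \<in> A" "y \<in> A" for x y
      proof -
        have xy: "x \<in> carrier G" "y \<in> carrier G" using that Ac by blast+
        then have "inv g \<otimes> (g \<otimes> (y \<otimes> inv g)) = y \<otimes> inv g" using g by (simp add: m_assoc[symmetric])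
        then show ?thesis using g xy by (simp add: m_assoc)
      qed
      then show ?thesis using inj into im by (simp add: iso_def hom_def bij_betw_def Pi_def)
    qed
    then have norm: "?f ` ?K \<lhd> ?A" using iso_normal_subgroup A.is_group K(1) by blast
    have "?K \<subseteq> A" using subgroup.subset[OF KA] by simp
    then have "card (?f ` ?K) = card ?K" using inj card_image inj_on_subset by blast
    moreover have NK: "N \<subseteq> ?K" using K(2) unfolding index_in_def by blast
    moreover have "N \<subseteq> ?f ` ?K"
    proof
      fix x assume "x \<in> N"
      then obtain y where "y \<in> N" "?f y = x" using onto[OF N] by blast
      then show "x \<in> ?f ` ?K" using NK by blast
    qed
    ultimately have "index_in P N (?f ` ?K)" using K(2) unfolding index_in_def by simp
    then show "?f h \<in> ?K" using K(3)[OF norm] h by blast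
  qed
qed

text \<open>Conjugation by \<open>s\<close> in \<open>S\<close> preserves both \<open>N\<close> and
  \<open>T\<close>, and conjugation by an element of \<open>N\<close> preserves any subgroup
  containing \<open>N\<close>.\<close>

lemma (in group) set_mult_normal_in:
  assumes N: "N \<lhd> G" and S: "subgroup S G" and T: "T \<lhd> G\<lparr>carrier := S\<rparr>"
  shows "N <#> T \<lhd> G\<lparr>carrier := N <#> S\<rparr>"
proof -
  interpret S: group "G\<lparr>carrier := S\<rparr>" by (rule subgroup_imp_group[OF S])
  have Ts: "subgroup T G" using incl_subgroup[OF S] T normal_imp_subgroup by blast
  have TS: "T \<subseteq> S" using subgroup.subset[OF normal_imp_subgroup[OF T]] by simp
  note NS = set_mult_normal_subgroup[OF N S] and NT = set_mult_normal_subgroup[OF N Ts]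
  interpret NS: group "G\<lparr>carrier := N <#> S\<rparr>" by (rule subgroup_imp_group[OF NS(1)])
  note m = subgroup.m_closed[OF NT(1)] and i = subgroup.m_inv_closed[OF NT(1)]
  have conj: "k \<otimes> h \<otimes> inv k \<in> N <#> T" if k: "k \<in> N <#> S" and h: "h \<in> N <#> T" for k h
  proof -
    obtain x s where xs: "x \<in> N" "s \<in> S" "k = x \<otimes> s" using k unfolding set_mult_def by blast
    obtain y t where yt: "y \<in> N" "t \<in> T" "h = y \<otimes> t" using h unfolding set_mult_def by blast
    have c: "x \<in> carrier G" "s \<in> carrier G" "y \<in> carrier G" "t \<in> carrier G"
      using xs yt subgroup.mem_carrier[OF normal_imp_subgroup[OF N]] subgroup.mem_carrier[OF S]
        subgroup.mem_carrier[OF Ts] by blast+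
    have "inv\<^bsub>G\<lparr>carrier := S\<rparr>\<^esub> s = inv s" using m_inv_consistent[OF S xs(2)] by simp
    then have "s \<otimes> t \<otimes> inv s \<in> T" using S.normal_invE(2)[OF T, of s t] xs yt by simp
    moreover have "s \<otimes> y \<otimes> inv s \<in> N" using normal_invE(2)[OF N c(2) yt(1)] .
    ultimately have in3: "x \<in> N <#> T" "s \<otimes> y \<otimes> inv s \<in> N <#> T" "s \<otimes> t \<otimes> inv s \<in> N <#> T"
      using xs(1) NT(2,3) by blast+
    have "x \<otimes> ((s \<otimes> y \<otimes> inv s) \<otimes> (s \<otimes> t \<otimes> inv s)) \<otimes> inv x \<in> N <#> T"
      by (rule m[OF m[OF in3(1) m[OF in3(2,3)]] i[OF in3(1)]])
    moreover have "x \<otimes> ((s \<otimes> y \<otimes> inv s) \<otimes> (s \<otimes> t \<otimes> inv s)) \<otimes> inv x = k \<otimes> h \<otimes> inv k"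
    proof -
      have "inv s \<otimes> (s \<otimes> z) = z" if "z \<in> carrier G" for z
        using c that by (simp add: m_assoc[symmetric])
      then show ?thesis using c unfolding xs(3) yt(3) by (simp add: m_assoc inv_mult_group)
    qed
    ultimately show ?thesis by simp
  qed
  show ?thesis
  proof (rule NS.normal_invI)
    show "subgroup (N <#> T) (G\<lparr>carrier := N <#> S\<rparr>)"
      using NT(1) NS(1) mono_set_mult[of N N T S G] TS subgroup_incl by blast
    show "x \<otimes>\<^bsub>G\<lparr>carrier := N <#> S\<rparr>\<^esub> h \<otimes>\<^bsub>G\<lparr>carrier := N <#> S\<rparr>\<^esub> inv\<^bsub>G\<lparr>carrier := N <#> S\<rparr>\<^esub> x \<in> N <#> T"
      if "x \<in> carrier (G\<lparr>carrier := N <#> S\<rparr>)" "h \<in> N <#> T" for x h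
      using that conj m_inv_consistent[OF NS(1)] by simp
  qed
qed

text \<open>Multiplying the series from \<open>p_solvable\<close> by \<open>N\<close> gives a
  subnormal chain from \<open>N\<close> to \<open>G\<close> whose factors are again
  \<open>p\<close>- or \<open>p'\<close>-groups. If \<open>N\<close> had no proper extension of
  these kinds normal in \<open>G\<close>, the chain could never leave \<open>N\<close>.\<close>

lemma (in group) p_solvable_normal_ext:
  assumes fin: "finite (carrier G)" and p: "Factorial_Ring.prime p" and sol: "p_solvable p G"
    and N: "N \<lhd> G" "N \<noteq> carrier G"
  obtains K where "K \<lhd> G" "K \<noteq> N"
    "index_in (\<lambda>m. \<exists>k. m = p ^ k) N K \<or> index_in (\<lambda>m. \<not> p dvd m) N K"
proof (rule ccontr)
  let ?ext = "\<lambda>L K. index_in (\<lambda>m. \<exists>k. m = p ^ k) L K \<or> index_in (\<lambda>m. \<not> p dvd m) L K"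
  note P = mult_closed_class_prime_power[OF p] and P' = mult_closed_class_not_dvd[OF p]
  assume "\<not> thesis"
  with that have none: "K = N" if "K \<lhd> G" "?ext N K" for K using that by blast
  obtain n and S :: "nat \<Rightarrow> 'a set" where S0: "S 0 = {\<one>}" and Sn: "S n = carrier G"
    and S: "\<And>i. i < n \<Longrightarrow> subgroup (S i) G \<and> subgroup (S (Suc i)) G \<and> S i \<subseteq> S (Suc i) \<and>
              S i \<lhd> G\<lparr>carrier := S (Suc i)\<rparr> \<and>
              (is_p_set p (carrier (G\<lparr>carrier := S (Suc i)\<rparr> Mod S i)) \<or>
               is_p'_set p (carrier (G\<lparr>carrier := S (Suc i)\<rparr> Mod S i)))"
    using sol unfolding p_solvable_def by blast
  have Ss: "subgroup (S i) G" if "i \<le> n" for i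
    using that S[of i] Sn subgroup_self by (cases "i = n") auto
  define L where "L i = N <#> S i" for i
  have L: "subgroup (L i) G" "N \<subseteq> L i" if "i \<le> n" for i
    unfolding L_def using set_mult_normal_subgroup[OF N(1) Ss[OF that]] by blast+
  have NL: "N \<lhd> G\<lparr>carrier := L i\<rparr>" if "i \<le> n" for i
    using normal_restrict_supergroup[OF L(1) N(1) L(2)] that by blast
  have LG: "group (G\<lparr>carrier := L i\<rparr>)" "finite (carrier (G\<lparr>carrier := L i\<rparr>))" if "i \<le> n" for i
    using subgroup_imp_group[OF L(1)[OF that]] finite_subset[OF subgroup.subset[OF L(1)[OF that]] fin]
    by simp_all
  have Ln: "L n = carrier G"
    unfolding L_def Sn using N(1) subgroup_self set_mult_normal_absorb normal_imp_subgroup subgroup.subset by metis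
  \<comment> \<open>The largest \<open>p\<close>- or \<open>p'\<close>-extension of \<open>N\<close> inside \<open>L i\<close> is normal in \<open>L (Suc i)\<close>, which allows to
    descend the subnormal chain.\<close>
  have noneL: "\<forall>K. K \<lhd> G\<lparr>carrier := L i\<rparr> \<longrightarrow> ?ext N K \<longrightarrow> K = N" if "i \<le> n" for i
    using that
  proof (induction i rule: inc_induct)
    case base
    show ?case using none Ln by simp
  next
    case (step i)
    then have i: "Suc i \<le> n" "i \<le> n" by auto
    interpret H: group "G\<lparr>carrier := L (Suc i)\<rparr>" by (rule LG(1)[OF i(1)])
    interpret A: group "G\<lparr>carrier := L i\<rparr>" by (rule LG(1)[OF i(2)])
    have LL: "L i \<lhd> G\<lparr>carrier := L (Suc i)\<rparr>"
      unfolding L_def using set_mult_normal_in N(1) S[of i] step by simp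
    have "K \<subseteq> N" if K: "K \<lhd> G\<lparr>carrier := L i\<rparr>" "index_in Q N K" and Q: "mult_closed_class Q"
      and Q_ext: "\<And>K. index_in Q N K \<Longrightarrow> ?ext N K" for K Q
    proof -
      note g = A.greatest_ext[OF LG(2)[OF i(2)] Q NL[OF i(2)]]
      have "greatest_ext Q (G\<lparr>carrier := L i\<rparr>) N \<lhd> G\<lparr>carrier := L (Suc i)\<rparr>"
        using H.greatest_ext_normal_in[OF LG(2)[OF i(1)] Q LL NL[OF i(1)] L(2)[OF i(2)]] by simp
      then have "greatest_ext Q (G\<lparr>carrier := L i\<rparr>) N = N" using step.IH Q_ext[OF g(2)] by blast
      then show ?thesis using g(3)[OF K] by simp
    qed
    from this[OF _ _ P] this[OF _ _ P'] show ?case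
      unfolding index_in_def by blast
  qed
  \<comment> \<open>Climb the chain: once \<open>L i = N\<close>, the next term is an extension of
    \<open>N\<close> of the excluded kind and normal in itself, hence equal to
    \<open>N\<close>.\<close>
  have "L i = N" if "i \<le> n" for i
    using that
  proof (induction i)
    case 0
    show ?case unfolding L_def S0
      using N(1) by (metis coset_mult_one normal_imp_subgroup r_coset_eq_set_mult subgroup.subset)
  next
    case (Suc i)
    then have i: "i < n" "i \<le> n" by auto
    interpret T: group "G\<lparr>carrier := S (Suc i)\<rparr>" using subgroup_imp_group Ss Suc.prems by blast
    interpret H: group "G\<lparr>carrier := L (Suc i)\<rparr>" by (rule LG(1)[OF Suc.prems])
    have "subgroup (S i) (G\<lparr>carrier := S (Suc i)\<rparr>)" using S[OF i(1)] normal_imp_subgroup by blast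
    from T.lagrange[OF this]
    have "card (S (Suc i)) = card (S i) * card (carrier (G\<lparr>carrier := S (Suc i)\<rparr> Mod S i))"
      by (simp add: FactGroup_def order_def mult.commute)
    then have "?ext (S i) (S (Suc i))"
      using S[OF i(1)] unfolding index_in_def is_p_set_def is_p'_set_def by blast
    then have "?ext (L i) (L (Suc i))"
      unfolding L_def
      using index_in_set_mult(1)[OF fin P N(1) Ss[OF i(2)] Ss[OF Suc.prems]]
        index_in_set_mult(1)[OF fin P' N(1) Ss[OF i(2)] Ss[OF Suc.prems]] by blast
    moreover have "L (Suc i) \<lhd> G\<lparr>carrier := L (Suc i)\<rparr>"
      using H.carrier_normal by simp
    ultimately show ?case using noneL[OF Suc.prems] Suc.IH[OF i(2)] by metis
  qed
  then show False using Ln N(2) by blast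
qed

section \<open>Actions of subgroups of prime power order on cosets\<close>

lemma (in group_action) prime_power_orbit:
  assumes q: "Factorial_Ring.prime q" and ord: "order G = q ^ a" and x: "x \<in> E"
  shows "(\<forall>g\<in>carrier G. \<phi> g x = x) \<or> q dvd card (orbit G \<phi> x)"
proof -
  have "card (orbit G \<phi> x) dvd q ^ a"
    using orbit_stabilizer_theorem[OF x] ord by (metis dvd_triv_left)
  then obtain j where j: "card (orbit G \<phi> x) = q ^ j"
    using q by (metis divides_primepow_nat)
  show ?thesis
  proof (cases j)
    case 0
    then obtain y where "orbit G \<phi> x = {y}" using j by (metis card_1_singletonE power_0)
    then have "orbit G \<phi> x = {x}" using orbit_refl[OF x] by auto
    then show ?thesis unfolding orbit_def by blast
  next
    case (Suc n)
    then show ?thesis using j by simp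
  qed
qed

text \<open>The inverse turns right multiplication into a left action; the maps are restricted to
  the cosets because \<open>Bij\<close> requires extensional functions.\<close>

lemma (in group) rcosets_action:
  assumes H: "subgroup H G"
  shows "group_action G (rcosets H) (\<lambda>g. \<lambda>Y\<in>rcosets H. Y #> inv g)"
proof -
  have Hc: "H \<subseteq> carrier G" by (rule subgroup.subset[OF H])
  have sub: "Y \<subseteq> carrier G" if "Y \<in> rcosets H" for Y
    by (rule subgroup.rcosets_carrier[OF H is_group that])
  have cl: "Y #> g \<in> rcosets H" if Y: "Y \<in> rcosets H" and g: "g \<in> carrier G" for Y g
  proof -
    obtain a where a: "a \<in> carrier G" "Y = H #> a" using Y unfolding RCOSETS_def by blast
    then have "Y #> g = H #> (a \<otimes> g)" using g Hc coset_mult_assoc by simp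
    then show ?thesis using a g Hc rcosetsI by simp
  qed
  have undo: "Y #> g #> inv g = Y" "Y #> inv g #> g = Y" if "Y \<in> rcosets H" "g \<in> carrier G" for Y g
    using sub[OF that(1)] that(2) by (simp_all add: coset_mult_assoc)
  have bij: "(\<lambda>Y\<in>rcosets H. Y #> inv g) \<in> Bij (rcosets H)" if g: "g \<in> carrier G" for g
  proof -
    have "bij_betw (\<lambda>Y. Y #> inv g) (rcosets H) (rcosets H)"
      by (rule bij_betw_byWitness[where f' = "\<lambda>Y. Y #> g"]) (use cl undo g in auto)
    then have "bij_betw (\<lambda>Y\<in>rcosets H. Y #> inv g) (rcosets H) (rcosets H)"
      by (subst bij_betw_cong[where g = "\<lambda>Y. Y #> inv g"]) auto
    then show ?thesis unfolding Bij_def by simp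
  qed
  have "(\<lambda>Y\<in>rcosets H. Y #> inv (g \<otimes> h)) =
      compose (rcosets H) (\<lambda>Y\<in>rcosets H. Y #> inv g) (\<lambda>Y\<in>rcosets H. Y #> inv h)"
    if "g \<in> carrier G" "h \<in> carrier G" for g h
    using that sub cl by (auto simp: compose_def inv_mult_group coset_mult_assoc intro!: restrict_ext)
  then have "(\<lambda>g. \<lambda>Y\<in>rcosets H. Y #> inv g) \<in> hom G (BijGroup (rcosets H))"
    unfolding hom_def using bij by (auto simp: BijGroup_def)
  then show ?thesis
    unfolding group_action_def group_hom_def group_hom_axioms_def
    using group_BijGroup is_group by blast
qed

text \<open>The stabilizer of the coset \<open>Hg\<close> is the conjugate of \<open>H\<close> by
  the inverse of \<open>g\<close>.\<close>

lemma (in group) rcoset_fixed_imp_conj: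
  assumes H: "subgroup H G" and gs: "g \<in> carrier G" "s \<in> carrier G"
    and fixed: "(H #> g) #> inv s = H #> g"
  shows "g \<otimes> s \<otimes> inv g \<in> H"
proof -
  have Hc: "H \<subseteq> carrier G" by (rule subgroup.subset[OF H])
  have "H #> (g \<otimes> inv s) = H #> g" using fixed gs Hc by (simp add: coset_mult_assoc)
  then have "H #> (g \<otimes> inv (g \<otimes> inv s)) = H"
    using gs Hc coset_mult_inv2[of H g "g \<otimes> inv s"] by simp
  then have "H #> (g \<otimes> s \<otimes> inv g) = H" using gs by (simp add: inv_mult_group m_assoc)
  then show ?thesis using coset_join1 H gs by simp
qed

text \<open>Every orbit of \<open>S\<close> on the cosets of \<open>H\<close> has length one or a
  multiple of \<open>q\<close>. With fewer than \<open>q\<close> cosets all are fixed; if their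
  number is prime to \<open>q\<close>, at least one is. For \<open>H\<close> a Sylow subgroup the
  second part is Sylow's conjugacy theorem.\<close>

lemma (in group) prime_power_subgroup_conj:
  assumes fin: "finite (carrier G)" and q: "Factorial_Ring.prime q"
    and H: "subgroup H G" and S: "subgroup S G" and cS: "card S = q ^ a"
  shows "card (rcosets H) < q \<Longrightarrow> g \<in> carrier G \<Longrightarrow> s \<in> S \<Longrightarrow> g \<otimes> s \<otimes> inv g \<in> H"
    and "\<not> q dvd card (rcosets H) \<Longrightarrow> \<exists>g\<in>carrier G. \<forall>s\<in>S. g \<otimes> s \<otimes> inv g \<in> H"
proof -
  let ?f = "\<lambda>g. \<lambda>Y\<in>rcosets H. Y #> inv g"
  let ?S = "G\<lparr>carrier := S\<rparr>"
  interpret act: group_action ?S "rcosets H" ?f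
    by (rule group_action.induced_action[OF rcosets_action[OF H] S])
  have ord: "order ?S = q ^ a" using cS by (simp add: order_def)
  have Hc: "H \<subseteq> carrier G" and Sc: "S \<subseteq> carrier G"
    using subgroup.subset[OF H] subgroup.subset[OF S] .
  have finE: "finite (rcosets H)"
    using rcosets_subset_PowG[OF H] fin by (meson finite_Pow_iff finite_subset)
  have orb_sub: "orbit ?S ?f Y \<subseteq> rcosets H" if "Y \<in> rcosets H" for Y
    using act.element_image that unfolding orbit_def by blast
  have conj: "g \<otimes> s \<otimes> inv g \<in> H"
    if "\<not> q dvd card (orbit ?S ?f (H #> g))" "g \<in> carrier G" "s \<in> S" for g s
  proof (rule rcoset_fixed_imp_conj[OF H])
    have Hg: "H #> g \<in> rcosets H" using rcosetsI[OF Hc that(2)] .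
    then show "(H #> g) #> inv s = H #> g"
      using act.prime_power_orbit[OF q ord Hg] that by auto
  qed (use that Sc in auto)
  show "g \<otimes> s \<otimes> inv g \<in> H" if small: "card (rcosets H) < q" and g: "g \<in> carrier G" and s: "s \<in> S"
  proof (rule conj[OF _ g s])
    have Hg: "H #> g \<in> rcosets H" using rcosetsI[OF Hc g] .
    have "card (orbit ?S ?f (H #> g)) < q"
      using card_mono[OF finE orb_sub[OF Hg]] small by simp
    moreover have "card (orbit ?S ?f (H #> g)) > 0"
      using act.orbit_refl[OF Hg] finite_subset[OF orb_sub[OF Hg] finE] by (auto simp: card_gt_0_iff)
    ultimately show "\<not> q dvd card (orbit ?S ?f (H #> g))" by (auto dest: dvd_imp_le)
  qed
  show "\<exists>g\<in>carrier G. \<forall>s\<in>S. g \<otimes> s \<otimes> inv g \<in> H" if nd: "\<not> q dvd card (rcosets H)"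
  proof -
    let ?O = "orbits ?S (rcosets H) ?f"
    have part: "partition (rcosets H) ?O" by (rule act.orbit_partition)
    have U: "\<Union>?O = rcosets H" using partition.partition_coverture[OF part] .
    have disj: "\<forall>c1\<in>?O. \<forall>c2\<in>?O. c1 \<noteq> c2 \<longrightarrow> c1 \<inter> c2 = {}"
      using partition.disjoint_union[OF part] by blast
    have "\<exists>c\<in>?O. \<not> q dvd card c"
      using dvd_partition[of ?O q] U finE disj nd by auto
    then obtain Y where Y: "Y \<in> rcosets H" "\<not> q dvd card (orbit ?S ?f Y)"
      unfolding orbits_def by blast
    then obtain g where "g \<in> carrier G" "Y = H #> g" unfolding RCOSETS_def by blast
    then show ?thesis using conj Y(2) by blast
  qed
qed

section \<open>Normalizers, maximal subgroups and a normal Sylow subgroup modulo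
  \<open>R\<close>\<close>

text \<open>For finite \<open>T\<close>, a conjugate of \<open>T\<close> contained in
  \<open>T\<close> equals \<open>T\<close>, since conjugation is injective.\<close>

lemma (in group) normalizer_iff:
  assumes T: "T \<subseteq> carrier G" "finite T"
  shows "g \<in> normalizer G T \<longleftrightarrow> g \<in> carrier G \<and> (\<forall>t\<in>T. g \<otimes> t \<otimes> inv g \<in> T)"
proof -
  have im: "g <# T #> inv g = (\<lambda>t. g \<otimes> t \<otimes> inv g) ` T" by (auto simp: l_coset_def r_coset_def)
  have "(\<lambda>t. g \<otimes> t \<otimes> inv g) ` T = T" if g: "g \<in> carrier G" and cl: "\<forall>t\<in>T. g \<otimes> t \<otimes> inv g \<in> T"
  proof (rule endo_inj_surj[OF T(2)])
    show "(\<lambda>t. g \<otimes> t \<otimes> inv g) ` T \<subseteq> T" using cl by blast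
    show "inj_on (\<lambda>t. g \<otimes> t \<otimes> inv g) T"
      by (rule inj_onI) (use T(1) conjugation_is_inj[OF g] in blast)
  qed
  then show ?thesis using T(1) im unfolding normalizer_def stabilizer_def by auto
qed

lemma (in group) maximal_subgroup_exists:
  assumes fin: "finite (carrier G)" and H: "subgroup H G" "H \<noteq> carrier G"
  obtains M where "maximal_subgroup G M" "H \<subseteq> M"
proof -
  let ?A = "{M. subgroup M G \<and> M \<noteq> carrier G \<and> H \<subseteq> M}"
  have "?A \<subseteq> Pow (carrier G)" using subgroup.subset by blast
  then have "finite ?A" using fin by (meson finite_Pow_iff finite_subset)
  moreover have "?A \<noteq> {}" using H by blast
  ultimately have "\<exists>M\<in>?A. \<forall>L\<in>?A. M \<subseteq> L \<longrightarrow> M = L" by (rule finite_has_maximal)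
  then obtain M where M: "M \<in> ?A" and max: "\<forall>L\<in>?A. M \<subseteq> L \<longrightarrow> M = L" ..
  have "maximal_subgroup G M" unfolding maximal_subgroup_def
  proof (intro conjI allI impI)
    fix L assume L: "subgroup L G \<and> M \<subseteq> L"
    show "L = M \<or> L = carrier G"
    proof (cases "L = carrier G")
      case False
      then have "L \<in> ?A" using L M by blast
      then show ?thesis using max L by blast
    qed simp
  qed (use M in auto)
  with M that show ?thesis by blast
qed

text \<open>\<open>T/R\<close> is the Sylow subgroup of \<open>G/R\<close> for the largest prime
  \<open>q\<close> dividing its order. Otherwise the normalizer of \<open>T\<close> would lie in a
  maximal subgroup of prime index below \<open>q\<close>, too small an index for \<open>Q\<close> to
  act nontrivially on the cosets.\<close>

lemma (in group) sylow_normal_ext: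
  assumes fin: "finite (carrier G)" and R: "R \<lhd> G" "R \<noteq> carrier G"
    and max: "\<And>M. maximal_subgroup G M \<Longrightarrow> R \<subseteq> M \<Longrightarrow> Factorial_Ring.prime (card (rcosets M))"
  obtains q T where "Factorial_Ring.prime q" "T \<lhd> G" "T \<noteq> R"
    "index_in (\<lambda>m. \<exists>k. m = q ^ k) R T" "index_in (\<lambda>m. \<not> q dvd m) T (carrier G)"
proof -
  have Rs: "subgroup R G" by (rule normal_imp_subgroup[OF R(1)])
  define c where "c = card (rcosets R)"
  have c: "card (carrier G) = card R * c"
    using lagrange[OF Rs] unfolding c_def order_def by (simp add: mult.commute)
  have posG: "card (carrier G) > 0" using card_subgroup_pos[OF fin subgroup_self] .
  have "c \<noteq> 1" using c R(2) card_subset_eq[OF fin subgroup.subset[OF Rs]] by auto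
  then have "\<exists>q. q \<in> {q. Factorial_Ring.prime q \<and> q dvd c}" using prime_factor_nat by blast
  moreover have "finite {q. Factorial_Ring.prime q \<and> q dvd c}"
    by (rule finite_subset[of _ "{..c}"]) (use c posG in \<open>auto dest: dvd_imp_le\<close>)
  ultimately obtain q where q: "Factorial_Ring.prime q" "q dvd c"
    and q_max: "\<And>r. Factorial_Ring.prime r \<Longrightarrow> r dvd c \<Longrightarrow> r \<le> q"
    using Max_in[of "{q. Factorial_Ring.prime q \<and> q dvd c}"]
      Max_ge[of "{q. Factorial_Ring.prime q \<and> q dvd c}"] by blast
  note P = mult_closed_class_prime_power[OF q(1)] and P' = mult_closed_class_not_dvd[OF q(1)]
  have "card (carrier G) \<noteq> 0" "\<not> is_unit q" using posG q(1) not_prime_unit by auto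
  then obtain m where m: "card (carrier G) = q ^ multiplicity q (card (carrier G)) * m" "\<not> q dvd m"
    using multiplicity_decompose' by blast
  define a where "a = multiplicity q (card (carrier G))"
  obtain Q where Q: "subgroup Q G" "card Q = q ^ a"
    using sylow_thm[OF q(1) is_group, of a m] m(1) fin unfolding a_def order_def by blast
  have cG: "card (carrier G) = card Q * m" using m(1) Q(2) unfolding a_def by simp
  define T where "T = R <#> Q"
  have T: "subgroup T G" "R \<subseteq> T" "Q \<subseteq> T"
    unfolding T_def by (rule set_mult_normal_subgroup[OF R(1) Q(1)])+
  have Tc: "T \<subseteq> carrier G" by (rule subgroup.subset[OF T(1)])
  have "{\<one>} \<subseteq> Q" using subgroup.one_closed[OF Q(1)] by simp
  then have "index_in (\<lambda>m. \<exists>k. m = q ^ k) {\<one>} Q" using Q(2) unfolding index_in_def by auto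
  from index_in_set_mult(1)[OF fin P R(1) triv_subgroup Q(1) this]
  have RT: "index_in (\<lambda>m. \<exists>k. m = q ^ k) R T"
    unfolding T_def using coset_mult_one[OF subgroup.subset[OF Rs]] by (simp add: r_coset_eq_set_mult)
  have "index_in (\<lambda>m. \<not> q dvd m) Q (carrier G)"
    using cG m(2) subgroup.subset[OF Q(1)] unfolding index_in_def by blast
  from index_in_between(2)[OF fin P' Q(1) T(1) subgroup_self T(3) Tc this]
  have TG: "index_in (\<lambda>m. \<not> q dvd m) T (carrier G)" .
  have TR: "T \<noteq> R"
  proof
    assume "T = R"
    then obtain m' where "card (carrier G) = card R * m'" "\<not> q dvd m'"
      using TG unfolding index_in_def by blast
    then show False using c q(2) posG by simp
  qed
  have "T \<lhd> G"
  proof (rule ccontr)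
    assume not_normal: "\<not> T \<lhd> G"
    have finT: "finite T" by (rule finite_subset[OF Tc fin])
    note norm = normalizer_iff[OF Tc finT]
    have Ns: "subgroup (normalizer G T) G" by (rule normalizer_imp_subgroup[OF Tc])
    have TN: "T \<subseteq> normalizer G T"
    proof
      fix g assume g: "g \<in> T"
      show "g \<in> normalizer G T"
        unfolding norm using g Tc subgroup.m_closed[OF T(1)] subgroup.m_inv_closed[OF T(1) g] by blast
    qed
    have "normalizer G T \<noteq> carrier G"
      using not_normal norm normal_invI[OF T(1)] by blast
    then obtain M where M: "maximal_subgroup G M" and NM: "normalizer G T \<subseteq> M"
      using maximal_subgroup_exists[OF fin Ns] by blast
    have Ms: "subgroup M G" "M \<noteq> carrier G" using M unfolding maximal_subgroup_def by blast+
    have sub: "R \<subseteq> M" "Q \<subseteq> M" using T TN NM by blast+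
    define r where "r = card (rcosets M)"
    have r: "Factorial_Ring.prime r" using max[OF M sub(1)] unfolding r_def .
    have rM: "r * card M = card (carrier G)" using lagrange[OF Ms(1)] unfolding r_def order_def .
    obtain d where d: "card M = card R * d" using card_subgroup_dvd[OF Rs Ms(1) sub(1)] by (rule dvdE)
    obtain e where e: "card M = card Q * e" using card_subgroup_dvd[OF Q(1) Ms(1) sub(2)] by (rule dvdE)
    have "card R * (r * d) = card R * c" using rM d c by (simp add: ac_simps)
    then have "r * d = c" using c posG by auto
    \<comment> \<open>As \<open>R\<close> lies in \<open>M\<close>, the index \<open>r\<close>
      divides that of \<open>R\<close>, so the choice of \<open>q\<close> bounds it.\<close>
    then have rq: "r \<le> q" using q_max[OF r] by (metis dvd_triv_left)
    have "card Q * (r * e) = card Q * m" using rM e cG by (simp add: ac_simps)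
    then have re: "r * e = m" using cG posG by auto
    then have "\<not> q dvd r" "\<not> q dvd e" using m(2) by auto
    \<comment> \<open>\<open>M\<close> contains the full Sylow subgroup \<open>Q\<close>, so
      \<open>r\<close> is prime to \<open>q\<close>; thus \<open>r\<close> differs from
      \<open>q\<close> and the bound is strict.\<close>
    then have small: "card (rcosets M) < q" using rq unfolding r_def by (cases "r = q") (auto simp: r_def)
    interpret M: group "G\<lparr>carrier := M\<rparr>" by (rule subgroup_imp_group[OF Ms(1)])
    have QM: "subgroup Q (G\<lparr>carrier := M\<rparr>)" by (rule subgroup_incl[OF Q(1) Ms(1) sub(2)])
    have finM: "finite (carrier (G\<lparr>carrier := M\<rparr>))"
      using finite_subset[OF subgroup.subset[OF Ms(1)] fin] by simp
    have "card (rcosets\<^bsub>G\<lparr>carrier := M\<rparr>\<^esub> Q) * card Q = e * card Q"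
      using M.lagrange[OF QM] e unfolding order_def by (simp add: mult.commute)
    then have "card (rcosets\<^bsub>G\<lparr>carrier := M\<rparr>\<^esub> Q) = e" using cG posG by auto
    then have nd: "\<not> q dvd card (rcosets\<^bsub>G\<lparr>carrier := M\<rparr>\<^esub> Q)" using \<open>\<not> q dvd e\<close> by simp
    \<comment> \<open>As \<open>Q\<close> fixes every coset of \<open>M\<close>, all conjugates of \<open>Q\<close> lie in \<open>M\<close> and are conjugate there to \<open>Q\<close>;
      now use the Frattini argument.\<close>
    have "g \<in> M" if g: "g \<in> carrier G" for g
    proof -
      let ?Q = "(\<lambda>s. g \<otimes> s \<otimes> inv g) ` Q"
      have "g <# Q #> inv g = ?Q" by (auto simp: l_coset_def r_coset_def)
      then have Qs: "subgroup ?Q G" using subgroup_conjugation_is_surj2[OF g Q(1)] by simp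
      have "inj_on (\<lambda>s. g \<otimes> s \<otimes> inv g) Q"
        by (rule inj_onI) (use subgroup.subset[OF Q(1)] conjugation_is_inj[OF g] in blast)
      then have cQ: "card ?Q = q ^ a" using Q(2) by (simp add: card_image)
      have "?Q \<subseteq> M"
        using prime_power_subgroup_conj(1)[OF fin q(1) Ms(1) Q(1) Q(2) small g] by blast
      then have "subgroup ?Q (G\<lparr>carrier := M\<rparr>)" by (rule subgroup_incl[OF Qs Ms(1)])
      from M.prime_power_subgroup_conj(2)[OF finM q(1) QM this cQ nd]
      obtain x where x: "x \<in> M" and "\<forall>s\<in>?Q. x \<otimes> s \<otimes> inv\<^bsub>G\<lparr>carrier := M\<rparr>\<^esub> x \<in> Q" by auto
      then have xQ: "x \<otimes> (g \<otimes> s \<otimes> inv g) \<otimes> inv x \<in> Q" if "s \<in> Q" for s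
        using that m_inv_consistent[OF Ms(1) x] by auto
      have xc: "x \<in> carrier G" by (rule subgroup.mem_carrier[OF Ms(1) x])
      \<comment> \<open>Conjugation by \<open>x \<otimes> g\<close> maps \<open>Q\<close> into
        \<open>Q\<close> and preserves the normal subgroup \<open>R\<close>. It therefore normalizes
        \<open>T\<close>, so \<open>x \<otimes> g\<close> lies in \<open>M\<close>, and cancelling
        \<open>x\<close> leaves \<open>g\<close>.\<close>
      let ?h = "x \<otimes> g"
      have hc: "?h \<in> carrier G" using xc g by simp
      have "?h \<otimes> t \<otimes> inv ?h \<in> T" if t: "t \<in> T" for t
      proof -
        obtain u s where us: "u \<in> R" "s \<in> Q" "t = u \<otimes> s" using t unfolding T_def set_mult_def by blast
        have uc: "u \<in> carrier G" and sc: "s \<in> carrier G"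
          using subgroup.mem_carrier[OF Rs us(1)] subgroup.mem_carrier[OF Q(1) us(2)] .
        have 1: "?h \<otimes> u \<otimes> inv ?h \<in> T" using normal_invE(2)[OF R(1) hc us(1)] T(2) by blast
        have "?h \<otimes> s \<otimes> inv ?h = x \<otimes> (g \<otimes> s \<otimes> inv g) \<otimes> inv x"
          using xc g sc by (simp add: m_assoc inv_mult_group)
        then have 2: "?h \<otimes> s \<otimes> inv ?h \<in> T" using xQ[OF us(2)] T(3) by auto
        have "inv ?h \<otimes> (?h \<otimes> (s \<otimes> inv ?h)) = s \<otimes> inv ?h"
          using inv_solve_left[of "s \<otimes> inv ?h" ?h "?h \<otimes> (s \<otimes> inv ?h)"] hc sc by simp
        then have "?h \<otimes> t \<otimes> inv ?h = (?h \<otimes> u \<otimes> inv ?h) \<otimes> (?h \<otimes> s \<otimes> inv ?h)"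
          using hc uc sc us(3) by (simp add: m_assoc del: inv_mult_group)
        then show ?thesis using subgroup.m_closed[OF T(1) 1 2] by simp
      qed
      then have "?h \<in> M" using norm hc NM by blast
      then have "inv x \<otimes> ?h \<in> M"
        using subgroup.m_closed[OF Ms(1)] subgroup.m_inv_closed[OF Ms(1) x] by blast
      then show ?thesis using xc g by (simp add: m_assoc[symmetric])
    qed
    then show False using Ms subgroup.subset[OF Ms(1)] by blast
  qed
  then show ?thesis using that q(1) TR RT TG by blast
qed

section \<open>The upper series reaches the group\<close>

lemma (in group) upper_pp_series_4:
  assumes fin: "finite (carrier G)" and p: "Factorial_Ring.prime p" and sol: "p_solvable p G"
    and max: "\<And>M. maximal_subgroup G M \<Longrightarrow>
      p_nilpotent_subgroup p G M \<or> Factorial_Ring.prime (card (rcosets M))"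
  shows "upper_pp_series p G 4 = carrier G"
proof -
  let ?U = "upper_pp_series p G"
  let ?P = "\<lambda>m. \<exists>k. m = p ^ k" and ?P' = "\<lambda>m. \<not> p dvd m"
  note P = mult_closed_class_prime_power[OF p] and P' = mult_closed_class_not_dvd[OF p]
  have U: "?U n \<lhd> G" for n by (rule upper_pp_series_normal[OF fin p])
  have Us: "subgroup (?U n) G" for n by (rule normal_imp_subgroup[OF U])
  have Uc: "?U n \<subseteq> carrier G" for n by (rule subgroup.subset[OF Us])
  have even: "index_in ?P' (?U n) (?U (Suc n))"
    "\<And>K. K \<lhd> G \<Longrightarrow> index_in ?P' (?U n) K \<Longrightarrow> K \<subseteq> ?U (Suc n)" if "even n" for n
    using greatest_ext(2,3)[OF fin P' U[of n]] upper_pp_series_Suc[OF fin p U[of n]] that by simp_all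
  have odd: "index_in ?P (?U n) (?U (Suc n))"
    "\<And>K. K \<lhd> G \<Longrightarrow> index_in ?P (?U n) K \<Longrightarrow> K \<subseteq> ?U (Suc n)" if "odd n" for n
    using greatest_ext(2,3)[OF fin P U[of n]] upper_pp_series_Suc[OF fin p U[of n]] that by simp_all
  have mono: "?U n \<subseteq> ?U (Suc n)" for n
    using even(1)[of n] odd(1)[of n] unfolding index_in_def by blast
  have Suc_n: "Suc 1 = 2" "Suc 2 = 3" "Suc 3 = 4" by simp_all
  have U12: "?U 1 \<subseteq> ?U 2" and U23: "?U 2 \<subseteq> ?U 3"
    using mono[of 1] mono[of 2] unfolding Suc_n .
  have e0: "K \<subseteq> ?U 1" if "K \<lhd> G" "index_in ?P' {\<one>} K" for K using even(2)[of 0 K] that by simp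
  have o1: "index_in ?P (?U 1) (?U 2)" "\<And>K. K \<lhd> G \<Longrightarrow> index_in ?P (?U 1) K \<Longrightarrow> K \<subseteq> ?U 2"
    using odd[of 1] unfolding Suc_n by simp_all
  have e2: "index_in ?P' (?U 2) (?U 3)" "\<And>K. K \<lhd> G \<Longrightarrow> index_in ?P' (?U 2) K \<Longrightarrow> K \<subseteq> ?U 3"
    using even[of 2] unfolding Suc_n by simp_all
  have o3: "K \<subseteq> ?U 4" if "K \<lhd> G" "index_in ?P (?U 3) K" for K
    using odd(2)[of 3 K] that unfolding Suc_n by simp
  have whole: "?U 4 = carrier G" if "carrier G \<subseteq> ?U n" "n \<le> 4" for n
  proof -
    have "?U n \<subseteq> ?U 4" using lift_Suc_mono_le[of ?U n 4] mono that(2) by blast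
    then show ?thesis using that(1) Uc[of 4] by blast
  qed
  let ?A = "?U 3"
  show ?thesis
  proof (cases "\<exists>M. maximal_subgroup G M \<and> p_nilpotent_subgroup p G M")
    case True
    then obtain M N k where M: "maximal_subgroup G M" and N: "N \<lhd> G\<lparr>carrier := M\<rparr>"
      and cN: "is_p'_set p N" "card M = card N * p ^ k"
      unfolding p_nilpotent_subgroup_def by blast
    have Ms: "subgroup M G" using M unfolding maximal_subgroup_def by blast
    interpret M: group "G\<lparr>carrier := M\<rparr>" by (rule subgroup_imp_group[OF Ms])
    have NM: "subgroup N (G\<lparr>carrier := M\<rparr>)" by (rule normal_imp_subgroup[OF N])
    have Ns: "subgroup N G" by (rule incl_subgroup[OF Ms NM])
    have N_sub: "N \<subseteq> M" using subgroup.subset[OF NM] by simp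
    have iNM: "index_in ?P N M" using cN(2) N_sub unfolding index_in_def by blast
    have i1N: "index_in ?P' {\<one>} N"
      using cN(1) subgroup.one_closed[OF Ns] unfolding index_in_def is_p'_set_def by simp
    show ?thesis
    proof (cases "?A \<subseteq> M")
      case True
      have finM: "finite (carrier (G\<lparr>carrier := M\<rparr>))"
        using finite_subset[OF subgroup.subset[OF Ms] fin] by simp
      interpret A: group "G\<lparr>carrier := ?A\<rparr>" by (rule subgroup_imp_group[OF Us])
      have finA: "finite (carrier (G\<lparr>carrier := ?A\<rparr>))" using finite_subset[OF Uc fin] by simp
      have AM: "?A \<lhd> G\<lparr>carrier := M\<rparr>" by (rule normal_restrict_supergroup[OF Ms U True])
      have L: "N \<inter> ?A \<lhd> G\<lparr>carrier := ?A\<rparr>"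
        using normal_inter[OF Ms Us[of 3] N] True by (simp add: Int_absorb1)
      have "index_in ?P (?A \<inter> N) (?A \<inter> M)"
        using M.index_in_set_mult(2)[OF finM P AM NM M.subgroup_self] iNM by simp
      then have LA: "index_in ?P (N \<inter> ?A) ?A" using True by (simp add: Int_commute Int_absorb1)
      have Ls: "subgroup (N \<inter> ?A) G" by (rule subgroups_Inter_pair[OF Ns Us[of 3]])
      have "index_in ?P' {\<one>} (N \<inter> ?A)"
        using index_in_between(1)[OF fin P' triv_subgroup Ls Ns _ _ i1N] subgroup.one_closed[OF Ls] by simp
      moreover note K = A.greatest_ext[OF finA P' A.one_is_normal, simplified]
      ultimately have "N \<inter> ?A \<subseteq> greatest_ext ?P' (G\<lparr>carrier := ?A\<rparr>) {\<one>}" using K(3)[OF L] by blast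
      \<comment> \<open>The left side is the largest normal \<open>p'\<close>-subgroup of
        \<open>?A\<close>. It is characteristic in \<open>?A\<close>, hence normal in
        \<open>G\<close>.\<close>
      moreover have "greatest_ext ?P' (G\<lparr>carrier := ?A\<rparr>) {\<one>} \<subseteq> ?U 1"
        using e0 greatest_ext_normal_in[OF fin P' U[of 3] one_is_normal] K(2) subgroup.one_closed[OF Us[of 3]] by simp
      ultimately have LU: "N \<inter> ?A \<subseteq> ?U 1" by blast
      have UA: "?U 1 \<subseteq> ?A" using U12 U23 by blast
      have "index_in ?P (?U 1) ?A" by (rule index_in_between(2)[OF fin P Ls Us Us LU UA LA])
      then have A2: "?A = ?U 2" using o1(2)[OF U] U23 by blast
      \<comment> \<open>Otherwise p-solvability yields a proper extension of \<open>?U 2\<close>. A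
        \<open>p\<close>-extension is absorbed since \<open>?U 2\<close> is already a
        \<open>p\<close>-extension of \<open>?U 1\<close>; a \<open>p'\<close>-extension lies in
        \<open>?U 3\<close>, which here equals \<open>?U 2\<close>.\<close>
      have "?U 2 = carrier G"
      proof (rule ccontr)
        assume "?U 2 \<noteq> carrier G"
        then obtain K where K: "K \<lhd> G" "K \<noteq> ?U 2" "index_in ?P (?U 2) K \<or> index_in ?P' (?U 2) K"
          using p_solvable_normal_ext[OF fin p sol U] by blast
        have "?U 2 \<subseteq> K" using K(3) unfolding index_in_def by blast
        moreover have "K \<subseteq> ?U 2" using K(3)
        proof
          assume "index_in ?P (?U 2) K"
          then have "index_in ?P (?U 1) K"
            using index_in_trans[OF P card_subgroup_pos[OF fin normal_imp_subgroup[OF K(1)]] o1(1)] by simp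
          then show ?thesis by (rule o1(2)[OF K(1)])
        next
          assume "index_in ?P' (?U 2) K"
          then show ?thesis using e2(2)[OF K(1)] A2 by simp
        qed
        ultimately show False using K(2) by blast
      qed
      then show ?thesis using whole[of 2] by simp
    next
      case False
      note AM = set_mult_normal_subgroup[OF U[of 3] Ms]
      have G: "?A <#> M = carrier G" using M AM False unfolding maximal_subgroup_def by blast
      \<comment> \<open>\<open>N\<close> is normal in \<open>M\<close>, so \<open>AN\<close> is
        normal in \<open>AM\<close>, which is all of \<open>G\<close>.\<close>
      have K: "?A <#> N \<lhd> G" using set_mult_normal_in[OF U[of 3] Ms N] G by simp
      have "index_in ?P' ?A (?A <#> N)"
        using index_in_set_mult(1)[OF fin P' U[of 3] triv_subgroup Ns i1N] coset_mult_one[OF Uc[of 3]]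
        by (simp add: r_coset_eq_set_mult)
      \<comment> \<open>Both \<open>AN/A\<close> and \<open>A/?U 2\<close> are
        \<open>p'\<close>-groups, so the maximality defining \<open>?U 3\<close> forces
        \<open>AN = A\<close>. Then \<open>G/A = AM/AN\<close> has \<open>p\<close>-power order, a
        divisor of the index of \<open>N\<close> in \<open>M\<close>.\<close>
      then have "index_in ?P' (?U 2) (?A <#> N)"
        using index_in_trans[OF P' card_subgroup_pos[OF fin normal_imp_subgroup[OF K]] e2(1)] by simp
      then have "?A <#> N \<subseteq> ?A" by (rule e2(2)[OF K])
      then have "?A <#> N = ?A" using set_mult_normal_subgroup(2)[OF U[of 3] Ns] by blast
      then have "index_in ?P ?A (carrier G)"
        using index_in_set_mult(1)[OF fin P U[of 3] Ns Ms iNM] G by simp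
      then show ?thesis using o3[OF carrier_normal] Uc[of 4] by blast
    qed
  next
    case False
    then have prime_index: "\<And>M. maximal_subgroup G M \<Longrightarrow> Factorial_Ring.prime (card (rcosets M))"
      using max by blast
    show ?thesis
    proof (cases "?U 1 = carrier G")
      case True
      then show ?thesis using whole[of 1] by simp
    next
      case False
      obtain q T where q: "Factorial_Ring.prime q" and T: "T \<lhd> G" "T \<noteq> ?U 1"
        and iT: "index_in (\<lambda>m. \<exists>k. m = q ^ k) (?U 1) T" "index_in (\<lambda>m. \<not> q dvd m) T (carrier G)"
        using sylow_normal_ext[OF fin U False prime_index] by blast
      have Ts: "subgroup T G" by (rule normal_imp_subgroup[OF T(1)])
      \<comment> \<open>For any other \<open>q\<close>, \<open>T\<close> would be a normal
        \<open>p'\<close>-subgroup of \<open>G\<close> strictly containing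
        \<open>?U 1\<close>.\<close>
      have "q = p"
      proof (rule ccontr)
        assume "q \<noteq> p"
        then have "\<not> p dvd q ^ k" for k
          using p q by (metis prime_dvd_power primes_dvd_imp_eq)
        then have "index_in ?P' (?U 1) T" using iT(1) unfolding index_in_def by blast
        then have "index_in ?P' {\<one>} T"
          using index_in_trans[OF P' card_subgroup_pos[OF fin Ts], of "{\<one>}" "?U 1"] even(1)[of 0] by simp
        then have "T \<subseteq> ?U 1" by (rule e0[OF T(1)])
        then show False using T(2) iT(1) unfolding index_in_def by blast
      qed
      then have "T \<subseteq> ?U 2" using o1(2)[OF T(1)] iT(1) by simp
      \<comment> \<open>\<open>T\<close> has index prime to \<open>p\<close> and lies in
        \<open>?U 2\<close>, so what remains above \<open>?U 2\<close> is a \<open>p'\<close>-group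
        and is absorbed by \<open>?U 3\<close>.\<close>
      then have "index_in ?P' (?U 2) (carrier G)"
        using index_in_between(2)[OF fin P' Ts Us subgroup_self _ Uc] iT(2) \<open>q = p\<close> by simp
      then show ?thesis using whole[of 3] e2(2)[OF carrier_normal] by simp
    qed
  qed
qed

theorem theoremD:
  fixes G :: "('a, 'b) monoid_scheme" and p :: nat
  assumes "group G" and "finite (carrier G)"
    and "Factorial_Ring.prime p" and "odd p"
    and "p_solvable p G"
    and "\<And>M. maximal_subgroup G M \<Longrightarrow>
           p_nilpotent_subgroup p G M \<or> Factorial_Ring.prime (card (rcosets\<^bsub>G\<^esub> M))"
  shows "upper_pp_series p G 5 = carrier G \<and> p_length p G \<le> 2"
proof -
  interpret group G by fact
  let ?U = "upper_pp_series p G"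
  have U4: "?U 4 = carrier G" using upper_pp_series_4 assms by blast
  have step: "?U n \<subseteq> ?U (Suc n)" "?U n \<subseteq> carrier G" for n
  proof -
    note N = upper_pp_series_normal[OF assms(2,3), of n]
    show "?U n \<subseteq> carrier G" by (rule subgroup.subset[OF normal_imp_subgroup[OF N]])
    show "?U n \<subseteq> ?U (Suc n)"
      using greatest_ext(2)[OF assms(2) _ N] mult_closed_class_not_dvd[OF assms(3)]
        mult_closed_class_prime_power[OF assms(3)]
      unfolding upper_pp_series_Suc[OF assms(2,3) N] index_in_def by simp
  qed
  have top: "?U n = carrier G" if "4 \<le> n" for n
    using lift_Suc_mono_le[of ?U 4 n] step that U4 by blast
  \<comment> \<open>Odd \<open>n\<close> marks the step from term \<open>n\<close> to term
    \<open>n + 1\<close>, which is taken with \<open>O_p\<close>. The series is constant from index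
    4 on, so only the steps starting at 1 and 3 can be proper.\<close>
  have "{n. odd n \<and> ?U n \<noteq> ?U (Suc n)} \<subseteq> {1, 3}"
  proof
    fix n assume n: "n \<in> {n. odd n \<and> ?U n \<noteq> ?U (Suc n)}"
    then have "n < 4" using top[of n] top[of "Suc n"] by (cases "4 \<le> n") auto
    then have "n = 0 \<or> n = 1 \<or> n = 2 \<or> n = 3" by linarith
    then show "n \<in> {1, 3}" using n by auto
  qed
  from card_mono[OF _ this] have "p_length p G \<le> 2" unfolding p_length_def by simp
  then show ?thesis using top[of 5] by simp
qed

end
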